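(* Consider CorrKO instances in which, for every vertex $v\ne\rho$, the pair $(S_v,R_v)$ equals $(S^{(1)}_v,R_v)$ with probability $p_v$ and $(S^{(2)}_v,0)$ with probability $1-p_v$, where $S^{(1)}_v>W/2\ge S^{(2)}_v$ are integers and $p_v\le 1/2$ (the reward $R_v$ on the first branch may be random). For every such instance there is a non-adaptive policy whose expected reward equals the optimal expected reward of an adaptive policy; i.e., the adaptivity gap for this class is $1$.
   Context: CorrKO: a finite metric $(V,d)$, root $\rho$, travel budget $B$, processing budget $W$; each vertex $v$ has random integer size $S_v\ge0$ and correlated random reward $R_v\ge0$, independent across vertices ($\rho$ has size and reward 0); a policy starts at $\rho$ and visits distinct vertices, processing jobs non-preemptively with $(S_v,R_v)$ revealed on completion; if it visits $\rho=v_0,\dots,v_\ell$ then $\sum_{i=1}^\ell d(v_{i-1},v_i)\le B$ and $\sum_{i=1}^{\ell-1}S_{v_i}\le W$, and the reward of $v_i$ is collected iff $\sum_{h\le i}S_{v_h}\le W$. Adaptive policies may choose the next vertex based on observed realizations; non-adaptive policies fix the vertex sequence in advance. *)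

theory Defs
  imports "HOL-Probability.Probability"
begin

record ('w, 'v) corrKO =
  sample :: "'w measure"
  verts :: "'v set"
  metric :: "'v \<Rightarrow> 'v \<Rightarrow> real"
  root :: 'v
  travel_budget :: real
  proc_budget :: real
  job_size :: "'v \<Rightarrow> 'w \<Rightarrow> nat"
  job_reward :: "'v \<Rightarrow> 'w \<Rightarrow> real"

text \<open>Size and reward of the same vertex may be arbitrarily correlated; only the pairs belonging
  to different vertices are independent. No integrability is required, since expected rewards are
  taken in \<^typ>\<open>ennreal\<close>.\<close>

definition corrKO_instance :: "('w, 'v) corrKO \<Rightarrow> bool" where
  "corrKO_instance I \<longleftrightarrow>
     prob_space (sample I) \<and>
     finite (verts I) \<and> Metric_space (verts I) (metric I) \<and> root I \<in> verts I \<and>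
     0 \<le> travel_budget I \<and> 0 \<le> proc_budget I \<and>
     (\<forall>v\<in>verts I. job_size I v \<in> sample I \<rightarrow>\<^sub>M count_space UNIV) \<and>
     (\<forall>v\<in>verts I. job_reward I v \<in> borel_measurable (sample I)) \<and>
     (\<forall>v\<in>verts I. \<forall>\<omega>\<in>space (sample I). 0 \<le> job_reward I v \<omega>) \<and>
     (\<forall>\<omega>\<in>space (sample I). job_size I (root I) \<omega> = 0 \<and> job_reward I (root I) \<omega> = 0) \<and>
     prob_space.indep_vars (sample I) (\<lambda>_. count_space UNIV \<Otimes>\<^sub>M borel)
       (\<lambda>v \<omega>. (job_size I v \<omega>, job_reward I v \<omega>)) (verts I)"

text \<open>A history lists the completed jobs (vertex, size, reward) in order of their visit, without
  the root. A policy maps the history to the next vertex, or to \<^term>\<open>None\<close> in order to stop.\<close>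

type_synonym 'v history = "('v \<times> nat \<times> real) list"
type_synonym 'v policy = "'v history \<Rightarrow> 'v option"

definition total_size :: "'v history \<Rightarrow> nat" where
  "total_size h = (\<Sum>(v, s, r)\<leftarrow>h. s)"

definition path_length :: "('v \<Rightarrow> 'v \<Rightarrow> real) \<Rightarrow> 'v list \<Rightarrow> real" where
  "path_length d vs = (\<Sum>i<length vs - 1. d (vs ! i) (vs ! Suc i))"

primrec run :: "('w, 'v) corrKO \<Rightarrow> 'v policy \<Rightarrow> 'w \<Rightarrow> nat \<Rightarrow> 'v history" where
  "run I \<pi> \<omega> 0 = []"
| "run I \<pi> \<omega> (Suc n) =
     (case \<pi> (run I \<pi> \<omega> n) of
        None \<Rightarrow> run I \<pi> \<omega> n
      | Some v \<Rightarrow> run I \<pi> \<omega> n @ [(v, job_size I v \<omega>, job_reward I v \<omega>)])"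

text \<open>Only the sizes of the jobs before the last one have to fit into the processing budget: the
  last job may overrun it, in which case its reward is not collected.\<close>

definition feasible_history :: "('w, 'v) corrKO \<Rightarrow> 'v history \<Rightarrow> bool" where
  "feasible_history I h \<longleftrightarrow>
     set (map fst h) \<subseteq> verts I \<and> distinct (root I # map fst h) \<and>
     path_length (metric I) (root I # map fst h) \<le> travel_budget I \<and>
     real (total_size (butlast h)) \<le> proc_budget I"

definition collected_reward :: "('w, 'v) corrKO \<Rightarrow> 'v history \<Rightarrow> real" where
  "collected_reward I h =
     (\<Sum>i<length h. if real (total_size (take (Suc i) h)) \<le> proc_budget I
                    then snd (snd (h ! i)) else 0)"

text \<open>Rewards may have arbitrary distributions on the reals, so a policy must depend measurably on
  what it has observed. Histories of length \<open>n\<close> are identified with functions on \<open>{..<n}\<close>.\<close>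

definition observation_space :: "('w, 'v) corrKO \<Rightarrow> ('v \<times> nat \<times> real) measure" where
  "observation_space I = count_space (verts I) \<Otimes>\<^sub>M (count_space UNIV \<Otimes>\<^sub>M borel)"

definition measurable_policy :: "('w, 'v) corrKO \<Rightarrow> 'v policy \<Rightarrow> bool" where
  "measurable_policy I \<pi> \<longleftrightarrow>
     (\<forall>n. (\<lambda>x. \<pi> (map x [0..<n]))
            \<in> (\<Pi>\<^sub>M i\<in>{..<n}. observation_space I) \<rightarrow>\<^sub>M count_space (insert None (Some ` verts I)))"

definition adaptive_policies :: "('w, 'v) corrKO \<Rightarrow> 'v policy set" where
  "adaptive_policies I =
     {\<pi>. measurable_policy I \<pi> \<and> (\<forall>\<omega>\<in>space (sample I). \<forall>n. feasible_history I (run I \<pi> \<omega> n))}"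

text \<open>Visit the vertices of \<open>\<sigma>\<close> in order, until the sequence ends or the processing budget has been
  exceeded.\<close>

definition sequence_policy :: "('w, 'v) corrKO \<Rightarrow> 'v list \<Rightarrow> 'v policy" where
  "sequence_policy I \<sigma> h =
     (if length h < length \<sigma> \<and> real (total_size h) \<le> proc_budget I
      then Some (\<sigma> ! length h) else None)"

definition nonadaptive_policies :: "('w, 'v) corrKO \<Rightarrow> 'v policy set" where
  "nonadaptive_policies I = {\<pi> \<in> adaptive_policies I. \<exists>\<sigma>. \<pi> = sequence_policy I \<sigma>}"

text \<open>A feasible policy visits distinct vertices, so it has stopped after
  \<^term>\<open>card (verts I)\<close> decisions.\<close>

definition expected_reward :: "('w, 'v) corrKO \<Rightarrow> 'v policy \<Rightarrow> ennreal" where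
  "expected_reward I \<pi> =
     (\<integral>\<^sup>+\<omega>. ennreal (collected_reward I (run I \<pi> \<omega> (card (verts I)))) \<partial>sample I)"

definition opt_adaptive :: "('w, 'v) corrKO \<Rightarrow> ennreal" where
  "opt_adaptive I = (SUP \<pi>\<in>adaptive_policies I. expected_reward I \<pi>)"

definition opt_nonadaptive :: "('w, 'v) corrKO \<Rightarrow> ennreal" where
  "opt_nonadaptive I = (SUP \<pi>\<in>nonadaptive_policies I. expected_reward I \<pi>)"

text \<open>The supremum over a class of instances of the ratio between the adaptive and the
  non-adaptive optimum, where the ratio of an instance whose optima are both \<open>0\<close> or both
  infinite counts as \<open>1\<close>.\<close>

definition adaptivity_gap :: "('w, 'v) corrKO set \<Rightarrow> ennreal" where
  "adaptivity_gap C = Inf {\<alpha>. 1 \<le> \<alpha> \<and> (\<forall>I\<in>C. opt_adaptive I \<le> \<alpha> * opt_nonadaptive I)}"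

text \<open>The reward is unconstrained (in particular possibly random) on the branch with size
  \<open>s\<^sub>1\<close>. As \<open>s\<^sub>1 \<noteq> s\<^sub>2\<close>, the two branches are disjoint events of total probability \<open>1\<close>.\<close>

definition two_branch_instances :: "('w, 'v) corrKO set" where
  "two_branch_instances =
     {I. corrKO_instance I \<and>
         (\<forall>v\<in>verts I - {root I}. \<exists>(s\<^sub>1::nat) (s\<^sub>2::nat) (p::real).
            real s\<^sub>1 > proc_budget I / 2 \<and> proc_budget I / 2 \<ge> real s\<^sub>2 \<and> p \<le> 1 / 2 \<and>
            \<P>(\<omega> in sample I. job_size I v \<omega> = s\<^sub>1) = p \<and>
            \<P>(\<omega> in sample I. job_size I v \<omega> = s\<^sub>2 \<and> job_reward I v \<omega> = 0) = 1 - p)}"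

end

theory Submission imports Defs begin

text \<open>A job on its first branch uses more than half of the processing budget, and a job on its second
  branch pays nothing. Hence a policy collects no reward after the first time it sees a first
  branch, and what it does from then on is irrelevant. Until then it only sees second branches,
  so it moves along a deterministic path, which the non-adaptive policy can follow as well. As
  \<open>p\<^sub>v < 1\<close>, independence yields an outcome \<open>\<omega>\<^sub>0\<close> in which every job is on its second branch, and
  this path is the run of the policy on \<open>\<omega>\<^sub>0\<close>. The supremum is attained because there are only
  finitely many paths.\<close>

section \<open>Sizes and rewards of growing histories\<close>

lemma total_size_snoc: "total_size (h @ [e]) = total_size h + fst (snd e)"
  by (simp add: total_size_def case_prod_unfold)

lemma total_size_ge_member: "e \<in> set h \<Longrightarrow> fst (snd e) \<le> total_size h"
  by (induction h) (auto simp: total_size_def)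

lemma collected_reward_snoc:
  "collected_reward I (h @ [e]) =
     collected_reward I h + (if real (total_size (h @ [e])) \<le> proc_budget I then snd (snd e) else 0)"
  unfolding collected_reward_def by (auto simp: nth_append intro!: sum.cong)

text \<open>Two jobs that each exceed half of the processing budget overrun it together. After one
  such job, a new job is therefore either too late to be paid or has reward 0.\<close>

lemma collected_reward_snoc_same:
  assumes "e \<in> set h" "real (fst (snd e)) > proc_budget I / 2"
    and "real (fst (snd e')) > proc_budget I / 2 \<or> snd (snd e') = 0"
  shows "collected_reward I (h @ [e']) = collected_reward I h"
  using assms total_size_ge_member[OF assms(1)]
  by (auto simp: collected_reward_snoc total_size_snoc)

section \<open>Feasible vertex sequences and the policies that follow them\<close>

lemma path_length_take_le:
  assumes "\<And>x y. 0 \<le> d x y"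
  shows "path_length d (take n vs) \<le> path_length d vs"
proof -
  have "path_length d (take n vs) = (\<Sum>i<length (take n vs) - 1. d (vs ! i) (vs ! Suc i))"
    unfolding path_length_def by (intro sum.cong) auto
  also have "\<dots> \<le> path_length d vs"
    unfolding path_length_def using assms by (intro sum_mono2) auto
  finally show ?thesis .
qed

text \<open>These are the conditions of \<open>feasible_history\<close> that do not depend on the
  outcome. The processing budget is left out because \<open>sequence_policy\<close> itself stops
  once it is exceeded.\<close>

definition feasible_sequence :: "('w, 'v) corrKO \<Rightarrow> 'v list \<Rightarrow> bool" where
  "feasible_sequence I \<sigma> \<longleftrightarrow> set \<sigma> \<subseteq> verts I \<and> distinct (root I # \<sigma>) \<and>
     path_length (metric I) (root I # \<sigma>) \<le> travel_budget I"

lemma feasible_sequence_of_history: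
  "feasible_history I h \<Longrightarrow> feasible_sequence I (map fst h)"
  by (simp add: feasible_history_def feasible_sequence_def)

lemma finite_feasible_sequences:
  assumes "finite (verts I)"
  shows "finite {\<sigma>. feasible_sequence I \<sigma>}"
  by (rule finite_subset[OF _ finite_subset_distinct[OF assms]])
     (auto simp: feasible_sequence_def)

text \<open>A job is started only while the total size is within the budget. The history before that
  job is the \<open>butlast\<close> of the new one, so only the last job can overrun the
  budget.\<close>

lemma run_sequence_policy:
  assumes "0 \<le> proc_budget I"
  shows "map fst (run I (sequence_policy I \<sigma>) \<omega> n) =
           take (length (run I (sequence_policy I \<sigma>) \<omega> n)) \<sigma> \<and>
         real (total_size (butlast (run I (sequence_policy I \<sigma>) \<omega> n))) \<le> proc_budget I"
proof (induction n)
  case 0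
  show ?case using assms by (simp add: total_size_def)
next
  case (Suc n)
  show ?case
  proof (cases "sequence_policy I \<sigma> (run I (sequence_policy I \<sigma>) \<omega> n)")
    case None
    then show ?thesis using Suc.IH by simp
  next
    case (Some v)
    then have "length (run I (sequence_policy I \<sigma>) \<omega> n) < length \<sigma>"
      "real (total_size (run I (sequence_policy I \<sigma>) \<omega> n)) \<le> proc_budget I"
      "v = \<sigma> ! length (run I (sequence_policy I \<sigma>) \<omega> n)"
      by (auto simp: sequence_policy_def split: if_splits)
    then show ?thesis
      using Suc.IH Some by (simp add: take_Suc_conv_app_nth)
  qed
qed

lemma measurable_sequence_policy:
  assumes "set \<sigma> \<subseteq> verts I"
  shows "measurable_policy I (sequence_policy I \<sigma>)"
  unfolding measurable_policy_def
proof
  fix n :: nat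
  let ?N = "count_space (insert None (Some ` verts I))"
  let ?M = "\<Pi>\<^sub>M i\<in>{..<n}. observation_space I"
  show "(\<lambda>x. sequence_policy I \<sigma> (map x [0..<n])) \<in> ?M \<rightarrow>\<^sub>M ?N"
  \<comment> \<open>At a fixed history length, the policy chooses between two constants by comparing
    a measurable sum of sizes with the budget. Beyond the end of \<sigma> it is constantly
    \<open>None\<close>.\<close>
  proof (cases "n < length \<sigma>")
    case True
    have "(\<lambda>x. fst (snd (x i))) \<in> ?M \<rightarrow>\<^sub>M count_space UNIV" if "i < n" for i
    proof -
      have "(\<lambda>x. x i) \<in> ?M \<rightarrow>\<^sub>M observation_space I"
        using that by (intro measurable_component_singleton) simp
      then show ?thesis
        by (rule measurable_compose) (simp add: observation_space_def)
    qed
    then have "(\<lambda>x. \<Sum>i<n. fst (snd (x i))) \<in> ?M \<rightarrow>\<^sub>M count_space UNIV"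
      by measurable
    moreover have "total_size (map x [0..<n]) = (\<Sum>i<n. fst (snd (x i)))"
      for x :: "nat \<Rightarrow> 'a \<times> nat \<times> real"
      by (simp add: total_size_def case_prod_unfold o_def interv_sum_list_conv_sum_set_nat
            atLeast0LessThan)
    ultimately have [measurable]: "(\<lambda>x. total_size (map x [0..<n])) \<in> ?M \<rightarrow>\<^sub>M count_space UNIV"
      by simp
    have [measurable]: "(\<lambda>x. Some (\<sigma> ! n)) \<in> ?M \<rightarrow>\<^sub>M ?N" "(\<lambda>x. None) \<in> ?M \<rightarrow>\<^sub>M ?N"
      using True assms by (auto simp: subset_iff)
    have "(\<lambda>x. if real (total_size (map x [0..<n])) \<le> proc_budget I then Some (\<sigma> ! n) else None)
        \<in> ?M \<rightarrow>\<^sub>M ?N"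
      by measurable
    with True show ?thesis
      by (simp add: sequence_policy_def cong: if_cong)
  next
    case False
    then show ?thesis by (simp add: sequence_policy_def)
  qed
qed

lemma sequence_policy_nonadaptive:
  assumes I: "corrKO_instance I" and \<sigma>: "feasible_sequence I \<sigma>"
  shows "sequence_policy I \<sigma> \<in> nonadaptive_policies I"
proof -
  have W: "0 \<le> proc_budget I" and "Metric_space (verts I) (metric I)"
    using I by (auto simp: corrKO_instance_def)
  then have d: "0 \<le> metric I x y" for x y
    by (simp add: Metric_space.nonneg)
  have "feasible_history I (run I (sequence_policy I \<sigma>) \<omega> n)" for \<omega> n
  proof -
    let ?h = "run I (sequence_policy I \<sigma>) \<omega> n"
    have h: "map fst ?h = take (length ?h) \<sigma>" "real (total_size (butlast ?h)) \<le> proc_budget I"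
      using run_sequence_policy[OF W] by auto
    \<comment> \<open>Exceeding the processing budget may cut the run short, but a prefix of
      \<sigma> is no longer than \<sigma>. The offset \<open>Suc\<close> in the instance counts the
      root.\<close>
    have "path_length (metric I) (root I # take (length ?h) \<sigma>) \<le> path_length (metric I) (root I # \<sigma>)"
      using path_length_take_le[of "metric I" "Suc (length ?h)" "root I # \<sigma>"] d by simp
    then show ?thesis
      using \<sigma> h(2) set_take_subset[of "length ?h" \<sigma>]
      unfolding feasible_history_def h(1) feasible_sequence_def by auto
  qed
  then show ?thesis
    using \<sigma> measurable_sequence_policy[of \<sigma> I]
    by (auto simp: nonadaptive_policies_def adaptive_policies_def feasible_sequence_def)
qed

section \<open>Comparison of a policy with its path on a reference outcome\<close>

lemma run_append: "n \<le> m \<Longrightarrow> \<exists>h. run I \<pi> \<omega> m = run I \<pi> \<omega> n @ h"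
  by (induction m rule: dec_induct) (auto split: option.splits)

lemma run_stopped: "n \<le> m \<Longrightarrow> \<pi> (run I \<pi> \<omega> n) = None \<Longrightarrow> run I \<pi> \<omega> m = run I \<pi> \<omega> n"
  by (induction m rule: dec_induct) auto

text \<open>The runs of \<pi> and of \<open>sequence_policy I \<sigma>\<close> on \<omega> are
  compared with the run of \<pi> on \<open>\<omega>\<^sub>0\<close>. All three share one history
  until a job on \<omega> exceeds half of the budget. Both runs on \<omega> append that same job,
  and afterwards neither gains any reward.\<close>

lemma collected_reward_run_eq_sequence_policy:
  assumes feas: "\<And>\<omega> n. \<omega> \<in> space (sample I) \<Longrightarrow> feasible_history I (run I \<pi> \<omega> n)"
    and \<omega>: "\<omega> \<in> space (sample I)" and \<omega>0: "\<omega>\<^sub>0 \<in> space (sample I)"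
    and branch: "\<And>v. v \<in> verts I - {root I} \<Longrightarrow> real (job_size I v \<omega>) > proc_budget I / 2 \<or>
           job_reward I v \<omega> = 0 \<and> job_size I v \<omega> = job_size I v \<omega>\<^sub>0 \<and> job_reward I v \<omega>\<^sub>0 = 0"
    and \<sigma>_def: "\<sigma> = map fst (run I \<pi> \<omega>\<^sub>0 n)"
  shows "collected_reward I (run I \<pi> \<omega> n) = collected_reward I (run I (sequence_policy I \<sigma>) \<omega> n)"
proof -
  define H where "H = run I \<pi> \<omega>"
  define H0 where "H0 = run I \<pi> \<omega>\<^sub>0"
  define S where "S = run I (sequence_policy I \<sigma>) \<omega>"
  define big where "big h \<longleftrightarrow> (\<exists>e\<in>set h. real (fst (snd e)) > proc_budget I / 2)"
    for h :: "'b history"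
  have visited: "v \<in> verts I - {root I}" if "\<pi> (run I \<pi> \<omega>' k) = Some v" "\<omega>' \<in> space (sample I)"
    for \<omega>' k v
    using feas[OF that(2), of "Suc k"] that(1) by (auto simp: feasible_history_def)
  have \<sigma>_verts: "v \<in> verts I - {root I}" if "v \<in> set \<sigma>" for v
    using feas[OF \<omega>0, of n] that unfolding feasible_history_def \<sigma>_def distinct.simps by blast
  have keep: "big (h @ [(v, job_size I v \<omega>, job_reward I v \<omega>)]) \<and>
      collected_reward I (h @ [(v, job_size I v \<omega>, job_reward I v \<omega>)]) = collected_reward I h"
    if "big h" "v \<in> verts I - {root I}" for h v
    using that branch[OF that(2)] by (auto simp: big_def intro!: collected_reward_snoc_same)
  \<comment> \<open>The second alternative compares only rewards: after a large job the two runs on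
    \<omega> may visit different vertices and stop at different times.\<close>
  have "H k = H0 k \<and> S k = H0 k \<or>
      big (H k) \<and> big (S k) \<and> collected_reward I (H k) = collected_reward I (S k)"
    if "k \<le> n" for k
    using that
  proof (induction k)
    case 0
    show ?case by (simp add: H_def H0_def S_def)
  next
    case (Suc k)
    then consider (same) "H k = H0 k" "S k = H0 k"
      | (big) "big (H k)" "big (S k)" "collected_reward I (H k) = collected_reward I (S k)"
      by auto
    then show ?case
    proof cases
      case big
      have "big (H (Suc k)) \<and> collected_reward I (H (Suc k)) = collected_reward I (H k)"
      proof (cases "\<pi> (H k)")
        case None
        then show ?thesis using big(1) by (simp add: H_def)
      next
        case (Some v)
        then show ?thesis using keep[OF big(1), of v] visited[OF _ \<omega>, of k v] by (simp add: H_def)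
      qed
      moreover have "big (S (Suc k)) \<and> collected_reward I (S (Suc k)) = collected_reward I (S k)"
      proof (cases "sequence_policy I \<sigma> (S k)")
        case None
        then show ?thesis using big(2) by (simp add: S_def)
      next
        case (Some v)
        then have "v \<in> set \<sigma>" by (auto simp: sequence_policy_def split: if_splits)
        then show ?thesis using keep[OF big(2), of v] \<sigma>_verts[of v] Some by (simp add: S_def)
      qed
      ultimately show ?thesis using big(3) by simp
    next
      case same
      show ?thesis
      proof (cases "\<pi> (H0 k)")
        case None
        \<comment> \<open>Stopping is permanent, so \<sigma> ends exactly where \<pi> stops and the
          sequence policy stops there too.\<close>
        then have "\<sigma> = map fst (H0 k)"
          using run_stopped[of k n \<pi> I \<omega>\<^sub>0] Suc.prems by (simp add: \<sigma>_def H0_def)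
        then have "sequence_policy I \<sigma> (H0 k) = None"
          by (simp add: sequence_policy_def)
        then show ?thesis
          using same None by (simp add: H_def H0_def S_def)
      next
        case (Some v)
        then have H0_Suc: "H0 (Suc k) = H0 k @ [(v, job_size I v \<omega>\<^sub>0, job_reward I v \<omega>\<^sub>0)]"
          by (simp add: H0_def)
        have v: "v \<in> verts I - {root I}"
          using visited \<omega>0 Some by (simp add: H0_def)
        obtain h where "run I \<pi> \<omega>\<^sub>0 n = H0 (Suc k) @ h"
          using run_append[OF Suc.prems, of I \<pi> \<omega>\<^sub>0] unfolding H0_def by blast
        then have "length (H0 k) < length \<sigma>" "\<sigma> ! length (H0 k) = v"
          by (auto simp: \<sigma>_def H0_Suc nth_append)
        \<comment> \<open>\<open>H0 k\<close> is the \<open>butlast\<close> of the feasible history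
          \<open>H0 (Suc k)\<close>. Hence the budget test in \<open>sequence_policy\<close> does
          not stop a visit that \<pi> makes.\<close>
        moreover have "real (total_size (H0 k)) \<le> proc_budget I"
          using feas[OF \<omega>0, of "Suc k"] H0_Suc by (simp add: feasible_history_def H0_def)
        ultimately have "sequence_policy I \<sigma> (H0 k) = Some v"
          by (simp add: sequence_policy_def)
        then have "H (Suc k) = H0 k @ [(v, job_size I v \<omega>, job_reward I v \<omega>)]"
            "S (Suc k) = H0 k @ [(v, job_size I v \<omega>, job_reward I v \<omega>)]"
          using same Some by (simp_all add: H_def S_def)
        \<comment> \<open>The appended triple is either large, which gives the second alternative
          with equal histories, or identical to the triple on \<open>\<omega>\<^sub>0\<close>, which
          preserves the first.\<close>
        then show ?thesis
          using branch[OF v] H0_Suc by (auto simp: big_def)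
      qed
    qed
  qed
  from this[of n] show ?thesis by (auto simp: H_def S_def)
qed

section \<open>Second branches and a common outcome for them\<close>

text \<open>Here \<open>z v\<close> is the second-branch size. That branch has probability 1 - p,
  which is at least 1/2, and almost surely the only alternative is a size above half of the
  budget.\<close>

lemma two_branch_second_branch:
  assumes "I \<in> two_branch_instances"
  obtains z where
    "\<And>v. v \<in> verts I - {root I} \<Longrightarrow>
       \<P>(\<omega> in sample I. job_size I v \<omega> = z v \<and> job_reward I v \<omega> = 0) > 0"
    "\<And>v. v \<in> verts I - {root I} \<Longrightarrow> AE \<omega> in sample I.
       real (job_size I v \<omega>) > proc_budget I / 2 \<or> job_size I v \<omega> = z v \<and> job_reward I v \<omega> = 0"
proof -
  have I: "corrKO_instance I" using assms by (simp add: two_branch_instances_def)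
  interpret prob_space "sample I" using I by (simp add: corrKO_instance_def)
  have "\<exists>z. \<P>(\<omega> in sample I. job_size I v \<omega> = z \<and> job_reward I v \<omega> = 0) > 0 \<and>
     (AE \<omega> in sample I. real (job_size I v \<omega>) > proc_budget I / 2 \<or>
        job_size I v \<omega> = z \<and> job_reward I v \<omega> = 0)"
    if v: "v \<in> verts I - {root I}" for v
  proof -
    obtain s1 s2 :: nat and p :: real where
      s: "real s1 > proc_budget I / 2" "proc_budget I / 2 \<ge> real s2" "p \<le> 1 / 2"
      and p1: "\<P>(\<omega> in sample I. job_size I v \<omega> = s1) = p"
      and p2: "\<P>(\<omega> in sample I. job_size I v \<omega> = s2 \<and> job_reward I v \<omega> = 0) = 1 - p"
      using assms v unfolding two_branch_instances_def by blast
    have [measurable]: "job_size I v \<in> sample I \<rightarrow>\<^sub>M count_space UNIV"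
      "job_reward I v \<in> borel_measurable (sample I)"
      using I v by (auto simp: corrKO_instance_def)
    let ?A = "{\<omega> \<in> space (sample I). job_size I v \<omega> = s1}"
    let ?B = "{\<omega> \<in> space (sample I). job_size I v \<omega> = s2 \<and> job_reward I v \<omega> = 0}"
    \<comment> \<open>The events are disjoint because \<open>s1\<close> lies above half of the
      budget and \<open>s2\<close> does not. Their probabilities p and 1 - p therefore exhaust the
      space.\<close>
    have "prob (?A \<union> ?B) = prob ?A + prob ?B"
      by (rule finite_measure_Union) (use s in auto)
    then have "prob (?A \<union> ?B) = 1" using p1 p2 by simp
    then have "AE \<omega> in sample I. \<omega> \<in> ?A \<union> ?B"
      by (simp add: prob_eq_1)
    then have "AE \<omega> in sample I. real (job_size I v \<omega>) > proc_budget I / 2 \<or>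
        job_size I v \<omega> = s2 \<and> job_reward I v \<omega> = 0"
      by (rule AE_mp) (use s in auto)
    then show ?thesis using p2 s(3) by (intro exI[of _ s2]) simp
  qed
  then obtain z where "\<forall>v\<in>verts I - {root I}.
      \<P>(\<omega> in sample I. job_size I v \<omega> = z v \<and> job_reward I v \<omega> = 0) > 0 \<and>
      (AE \<omega> in sample I. real (job_size I v \<omega>) > proc_budget I / 2 \<or>
        job_size I v \<omega> = z v \<and> job_reward I v \<omega> = 0)"
    using bchoice[of "verts I - {root I}"] by meson
  then show ?thesis by (intro that[of z]) simp_all
qed

text \<open>By independence the intersection of the events has a product of positive numbers as its
  probability, so it contains a point. For empty \<open>J\<close> the product rule is replaced by
  nonemptiness of the space.\<close>

lemma (in prob_space) indep_vars_simultaneous: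
  assumes "indep_vars N X J" "finite J"
    and "\<And>i. i \<in> J \<Longrightarrow> A i \<in> sets (N i)"
    and "\<And>i. i \<in> J \<Longrightarrow> prob (X i -` A i \<inter> space M) > 0"
  shows "\<exists>\<omega>\<in>space M. \<forall>i\<in>J. X i \<omega> \<in> A i"
proof (cases "J = {}")
  case True
  then show ?thesis using not_empty by auto
next
  case False
  have "prob (\<Inter>i\<in>J. X i -` A i \<inter> space M) = (\<Prod>i\<in>J. prob (X i -` A i \<inter> space M))"
    using assms False by (intro indep_varsD) auto
  also have "\<dots> > 0" using assms(4) by (intro prod_pos) auto
  finally have "(\<Inter>i\<in>J. X i -` A i \<inter> space M) \<noteq> {}"
    by (metis less_irrefl measure_empty)
  with False show ?thesis by auto
qed

text \<open>The path \<sigma> of \<pi> on an outcome with only second branches is fixed before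
  \<omega> is drawn. The rewards of \<pi> and of following \<sigma> then agree almost surely, hence
  in expectation.\<close>

lemma two_branch_expected_reward:
  assumes I2: "I \<in> two_branch_instances" and \<pi>: "\<pi> \<in> adaptive_policies I"
  shows "\<exists>\<sigma>. feasible_sequence I \<sigma> \<and> expected_reward I \<pi> = expected_reward I (sequence_policy I \<sigma>)"
proof -
  have I: "corrKO_instance I" using I2 by (simp add: two_branch_instances_def)
  interpret prob_space "sample I" using I by (simp add: corrKO_instance_def)
  have fin: "finite (verts I)" using I by (simp add: corrKO_instance_def)
  have feas: "feasible_history I (run I \<pi> \<omega> n)" if "\<omega> \<in> space (sample I)" for \<omega> n
    using \<pi> that by (simp add: adaptive_policies_def)
  obtain z where pos: "\<And>v. v \<in> verts I - {root I} \<Longrightarrow>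
       \<P>(\<omega> in sample I. job_size I v \<omega> = z v \<and> job_reward I v \<omega> = 0) > 0"
    and ae: "\<And>v. v \<in> verts I - {root I} \<Longrightarrow> AE \<omega> in sample I.
       real (job_size I v \<omega>) > proc_budget I / 2 \<or> job_size I v \<omega> = z v \<and> job_reward I v \<omega> = 0"
    using two_branch_second_branch[OF I2] by blast
  have "\<exists>\<omega>\<in>space (sample I). \<forall>v\<in>verts I - {root I}.
      (job_size I v \<omega>, job_reward I v \<omega>) \<in> {(z v, 0)}"
  proof (rule indep_vars_simultaneous)
    show "indep_vars (\<lambda>_. count_space UNIV \<Otimes>\<^sub>M borel)
        (\<lambda>v \<omega>. (job_size I v \<omega>, job_reward I v \<omega>)) (verts I - {root I})"
      using I by (auto simp: corrKO_instance_def intro: indep_vars_subset)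
    fix v assume v: "v \<in> verts I - {root I}"
    have "{(z v, 0)} = {z v} \<times> {0::real}" by auto
    also have "\<dots> \<in> sets (count_space UNIV \<Otimes>\<^sub>M borel)" by (intro pair_measureI) auto
    finally show "{(z v, 0::real)} \<in> sets (count_space UNIV \<Otimes>\<^sub>M borel)" .
    have "(\<lambda>\<omega>. (job_size I v \<omega>, job_reward I v \<omega>)) -` {(z v, 0)} \<inter> space (sample I) =
        {\<omega> \<in> space (sample I). job_size I v \<omega> = z v \<and> job_reward I v \<omega> = 0}"
      by auto
    then show "prob ((\<lambda>\<omega>. (job_size I v \<omega>, job_reward I v \<omega>)) -` {(z v, 0)} \<inter> space (sample I)) > 0"
      using pos[OF v] by simp
  qed (use fin in simp)
  then obtain \<omega>0 where \<omega>0: "\<omega>0 \<in> space (sample I)"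
    "\<And>v. v \<in> verts I - {root I} \<Longrightarrow> job_size I v \<omega>0 = z v \<and> job_reward I v \<omega>0 = 0"
    by auto
  \<comment> \<open>The number of steps is the one at which \<open>expected_reward\<close> evaluates
    a run.\<close>
  define \<sigma> where "\<sigma> = map fst (run I \<pi> \<omega>0 (card (verts I)))"
  have "AE \<omega> in sample I. \<forall>v\<in>verts I - {root I}.
       real (job_size I v \<omega>) > proc_budget I / 2 \<or> job_size I v \<omega> = z v \<and> job_reward I v \<omega> = 0"
    using fin ae by (intro AE_finite_allI) auto
  then have "AE \<omega> in sample I. collected_reward I (run I \<pi> \<omega> (card (verts I))) =
      collected_reward I (run I (sequence_policy I \<sigma>) \<omega> (card (verts I)))"
  proof (rule AE_mp, intro AE_I2 impI)
    fix \<omega> assume "\<omega> \<in> space (sample I)" and "\<forall>v\<in>verts I - {root I}.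
       real (job_size I v \<omega>) > proc_budget I / 2 \<or> job_size I v \<omega> = z v \<and> job_reward I v \<omega> = 0"
    then show "collected_reward I (run I \<pi> \<omega> (card (verts I))) = 
        collected_reward I (run I (sequence_policy I \<sigma>) \<omega> (card (verts I)))"
      using \<omega>0 by (intro collected_reward_run_eq_sequence_policy[OF feas _ \<omega>0(1) _ \<sigma>_def]) auto
  qed
  then have "expected_reward I \<pi> = expected_reward I (sequence_policy I \<sigma>)"
    unfolding expected_reward_def by (intro nn_integral_cong_AE) auto
  then show ?thesis
    using feasible_sequence_of_history[OF feas[OF \<omega>0(1)]] \<sigma>_def by blast
qed

section \<open>Attainment of the optimum and the adaptivity gap\<close>

lemma two_branch_opt_attained:
  assumes I2: "I \<in> two_branch_instances"
  shows "\<exists>\<pi>\<in>nonadaptive_policies I. expected_reward I \<pi> = opt_adaptive I"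
proof -
  have I: "corrKO_instance I" using I2 by (simp add: two_branch_instances_def)
  let ?E = "(\<lambda>\<sigma>. expected_reward I (sequence_policy I \<sigma>)) ` {\<sigma>. feasible_sequence I \<sigma>}"
  have nonadaptive: "sequence_policy I \<sigma> \<in> nonadaptive_policies I" if "feasible_sequence I \<sigma>" for \<sigma>
    using sequence_policy_nonadaptive[OF I that] .
  \<comment> \<open>The adaptive policies realize only the finitely many values in
    \<open>?E\<close>, so their supremum is a maximum, attained by a sequence policy.\<close>
  have "?E = expected_reward I ` adaptive_policies I"
  proof (intro equalityI subsetI)
    fix x assume "x \<in> ?E"
    then show "x \<in> expected_reward I ` adaptive_policies I"
      using nonadaptive by (auto simp: nonadaptive_policies_def)
  next
    fix x assume "x \<in> expected_reward I ` adaptive_policies I"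
    then show "x \<in> ?E"
      using two_branch_expected_reward[OF I2] by auto
  qed
  then have opt: "opt_adaptive I = Sup ?E" by (simp add: opt_adaptive_def)
  \<comment> \<open>Staying at the root has path length 0, within the nonnegative travel budget.
    This makes \<open>?E\<close> nonempty, as \<open>Max\<close> requires.\<close>
  have "feasible_sequence I []"
    using I by (simp add: corrKO_instance_def feasible_sequence_def path_length_def)
  then have "?E \<noteq> {}" by blast
  moreover have "finite ?E"
    using finite_feasible_sequences[of I] I by (simp add: corrKO_instance_def)
  ultimately have "Max ?E \<in> ?E" "Sup ?E = Max ?E"
    using Max_in Max_Sup by metis+
  then show ?thesis using opt nonadaptive by auto
qed

theorem theorem5p2:
  shows "(\<forall>I \<in> (two_branch_instances :: ('w, 'v) corrKO set).
            \<exists>\<pi> \<in> nonadaptive_policies I. expected_reward I \<pi> = opt_adaptive I) \<and>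
         adaptivity_gap (two_branch_instances :: ('w, 'v) corrKO set) = 1"
proof
  show "\<forall>I \<in> (two_branch_instances :: ('w, 'v) corrKO set).
      \<exists>\<pi> \<in> nonadaptive_policies I. expected_reward I \<pi> = opt_adaptive I"
    using two_branch_opt_attained by blast
  have "opt_adaptive I \<le> 1 * opt_nonadaptive I"
    if I: "I \<in> (two_branch_instances :: ('w, 'v) corrKO set)" for I
  proof -
    obtain \<pi> where "\<pi> \<in> nonadaptive_policies I" "expected_reward I \<pi> = opt_adaptive I"
      using two_branch_opt_attained[OF I] by blast
    then show ?thesis
      using SUP_upper[of \<pi> "nonadaptive_policies I" "expected_reward I"]
      by (simp add: opt_nonadaptive_def)
  qed
  \<comment> \<open>The bound makes 1 an admissible ratio, and the constraint that ratios be at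
    least 1 makes it the infimum.\<close>
  then show "adaptivity_gap (two_branch_instances :: ('w, 'v) corrKO set) = 1"
    unfolding adaptivity_gap_def by (intro Inf_eqI) auto
qed

end
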